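(* For every complex number $a$ with $3a\notin\{0,-1,-2,\dots\}$, $$F_1\left(2a;\,a+\tfrac12,\,5a-\tfrac32;\,3a;\,\tfrac3{128},\tfrac38\right)=\frac{2^{16a}}{3^{3a}5^{5a}}\,\frac{\sqrt\pi\,\Gamma(3a)}{\Gamma(a+1/2)\,\Gamma(2a)}.$$
   Context: Appell's hypergeometric series is $F_1(\alpha;\beta_1,\beta_2;\gamma;x,y)=\sum_{m,n\ge0}\frac{(\alpha,m+n)(\beta_1,m)(\beta_2,n)}{(\gamma,m+n)(1,m)(1,n)}x^my^n$ for $\gamma\notin\{0,-1,-2,\dots\}$, absolutely convergent for $|x|<1$, $|y|<1$, where $(\alpha,n)=\alpha(\alpha+1)\cdots(\alpha+n-1)$, $(\alpha,0)=1$. For real $r>0$, $r^{a}=e^{a\log r}$ with real $\log r$. $1/\Gamma$ is the entire function (zero at the poles of $\Gamma$). *)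

theory Defs
  imports "HOL-Analysis.Analysis"
begin

text \<open>The Pochhammer symbol \<open>(\<alpha>, n)\<close> is \<open>pochhammer \<alpha> n\<close>. The double series is taken as an unordered
  sum, so it has its intended value only where it converges absolutely, in particular for
  \<open>\<gamma> \<notin> \<int>\<^sub>\<le>\<^sub>0\<close>, \<open>norm x < 1\<close> and \<open>norm y < 1\<close>.\<close>

definition appell_F1 ::
    "complex \<Rightarrow> complex \<Rightarrow> complex \<Rightarrow> complex \<Rightarrow> complex \<Rightarrow> complex \<Rightarrow> complex" where
  "appell_F1 \<alpha> \<beta>1 \<beta>2 \<gamma> x y =
     (\<Sum>\<^sub>\<infinity>(m, n)\<in>UNIV.
        pochhammer \<alpha> (m + n) * pochhammer \<beta>1 m * pochhammer \<beta>2 n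
          / (pochhammer \<gamma> (m + n) * pochhammer 1 m * pochhammer 1 n) * x ^ m * y ^ n)"

end

(* For real a > 1, Euler's integral turns the left-hand side into an integral over [0,1] of
   phi(t)^a w(t), where phi(t) = t^2 (1-t) / ((1 - 3t/128) (1 - 3t/8)^5) and w is independent of a.
   The parameters 3/128 and 3/8 are such that 1 - phi/C, with C = 2^16 / (3^3 5^5) the maximum of phi
   on [0,1], equals P^2 / (4 (1 - 3t/128) (1 - 3t/8)^5) for a cubic P.  Hence v = sqrt (1 - phi/C), with
   the sign of P, is a smooth substitution, and s = (1 - v)/2 carries the integral to a multiple of
   the Beta integral B(a,a).  Both sides are holomorphic in a off the poles of Gamma(3a), so
   the identity theorem gives the general case. *)

theory Submission
  imports Defs "HOL-Complex_Analysis.Complex_Analysis"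
begin

section \<open>Convergence and holomorphy of the Appell series\<close>

text \<open>For \<open>k > R\<close> the factor \<open>(p + k) / (q + k)\<close> has norm at most
  \<open>(R + k) / (k - R)\<close>, which tends to 1, so only finitely many factors can exceed
  \<open>r\<close>; \<open>\<delta>\<close> keeps the denominators of those away from 0. The
  constant depends only on \<open>R\<close>, \<open>\<delta>\<close> and \<open>r\<close>, as a
  majorant uniform in the parameters requires.\<close>

lemma pochhammer_quotient_bound:
  fixes R \<delta> r :: real
  assumes "R > 0" "\<delta> > 0" "r > 1"
  shows "\<exists>C>0. \<forall>p q :: 'a :: real_normed_field. norm p \<le> R \<longrightarrow> norm q \<le> R \<longrightarrow>
           (\<forall>j. \<delta> \<le> norm (q + of_nat j)) \<longrightarrow>
           (\<forall>k. norm (pochhammer p k / pochhammer q k) \<le> C * r ^ k)"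
proof -
  \<comment> \<open>From \<open>k = N\<close> on, \<open>R * (r + 1) \<le> k * (r - 1)\<close>,
    which rearranges to \<open>(R + k) / (k - R) \<le> r\<close>.\<close>
  define N where "N = nat \<lceil>R * (r + 1) / (r - 1)\<rceil>"
  define D where "D = max 1 ((R + real N) / \<delta>)"
  have D1: "D \<ge> 1" by (simp add: D_def)
  show ?thesis
  proof (intro exI[of _ "D ^ N"] conjI allI impI)
    show "D ^ N > 0" using D1 by simp
  next
    fix p q :: 'a and k
    assume pq: "norm p \<le> R" "norm q \<le> R" and "\<forall>j. \<delta> \<le> norm (q + of_nat j)"
    then have \<delta>: "\<delta> \<le> norm (q + of_nat j)" for j by blast
    \<comment> \<open>The exponent \<open>min k N\<close> counts the exceptional factors met so far,
      each of which costs an extra \<open>D\<close>.\<close>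
    have "norm (pochhammer p k / pochhammer q k) \<le> D ^ min k N * r ^ k"
    proof (induction k)
      case (Suc k)
      have pos: "norm (q + of_nat k) > 0"
        using \<delta>[of k] assms by linarith
      have num: "norm (p + of_nat k) \<le> R + real k"
        using norm_triangle_ineq[of p "of_nat k"] pq by simp
      have step: "norm ((p + of_nat k) / (q + of_nat k)) \<le> (if k < N then D else 1) * r"
      proof (cases "k < N")
        case True
        have "norm (p + of_nat k) / norm (q + of_nat k) \<le> (R + real N) / \<delta>"
          using num \<delta>[of k] assms True by (intro frac_le) auto
        also have "\<dots> \<le> D * 1"
          by (simp add: D_def)
        also have "\<dots> \<le> D * r"
          using D1 assms by (intro mult_left_mono) auto
        finally show ?thesis
          using True by (simp add: norm_divide)
      next
        case False
        then have "R * (r + 1) / (r - 1) \<le> real k"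
          unfolding N_def by linarith
        then have "R * (r + 1) \<le> real k * (r - 1)"
          using assms by (simp add: divide_le_eq)
        then have "R + real k \<le> r * (real k - R)"
          by (simp add: algebra_simps)
        also have "real k - R \<le> norm (q + of_nat k)"
          using norm_triangle_ineq2[of "of_nat k" "- q"] pq by (simp add: add.commute)
        finally have "norm (p + of_nat k) \<le> r * norm (q + of_nat k)"
          using num assms by simp
        then show ?thesis
          using False pos by (simp add: norm_divide divide_le_eq)
      qed
      have "norm (pochhammer p (Suc k) / pochhammer q (Suc k))
          = norm (pochhammer p k / pochhammer q k) * norm ((p + of_nat k) / (q + of_nat k))"
        by (simp add: pochhammer_Suc norm_mult norm_divide)
      also have "\<dots> \<le> (D ^ min k N * r ^ k) * ((if k < N then D else 1) * r)"
        using Suc step D1 assms by (intro mult_mono) auto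
      also have "\<dots> = D ^ min (Suc k) N * r ^ Suc k"
        by (auto simp: min_def not_less_eq_eq Suc_le_eq)
      finally show ?case .
    qed simp
    also have "\<dots> \<le> D ^ N * r ^ k"
      using D1 assms by (intro mult_right_mono power_increasing) auto
    finally show "norm (pochhammer p k / pochhammer q k) \<le> D ^ N * r ^ k" .
  qed
qed

lemma abs_summable_on_mult_Times:
  fixes f :: "'a \<Rightarrow> 'c :: {real_normed_field, banach}" and g :: "'b \<Rightarrow> 'c"
  assumes "Infinite_Sum.abs_summable_on f A" "Infinite_Sum.abs_summable_on g B"
  shows "Infinite_Sum.abs_summable_on (\<lambda>(x, y). f x * g y) (A \<times> B)"
  using assms
  by (simp add: Infinite_Sum.abs_summable_on_Sigma_iff norm_mult infsum_cmult_right' summable_on_cmult_right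
      summable_on_cmult_left abs_mult infsum_nonneg)

lemma infsum_mult_Times:
  fixes f :: "'a \<Rightarrow> 'c :: {real_normed_field, banach}" and g :: "'b \<Rightarrow> 'c"
  assumes "Infinite_Sum.abs_summable_on f A" "Infinite_Sum.abs_summable_on g B"
  shows "(\<Sum>\<^sub>\<infinity>(x, y)\<in>A \<times> B. f x * g y) = (\<Sum>\<^sub>\<infinity>x\<in>A. f x) * (\<Sum>\<^sub>\<infinity>y\<in>B. g y)"
proof -
  have "(\<Sum>\<^sub>\<infinity>x\<in>A. \<Sum>\<^sub>\<infinity>y\<in>B. f x * g y) = (\<Sum>\<^sub>\<infinity>(x, y)\<in>A \<times> B. f x * g y)"
    by (rule infsum_Sigma'_banach[OF abs_summable_summable[OF abs_summable_on_mult_Times[OF assms]]])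
  then show ?thesis
    by (simp add: infsum_cmult_right' infsum_cmult_left')
qed

lemma summable_on_geometric:
  fixes q :: real
  assumes "0 \<le> q" "q < 1"
  shows "(\<lambda>n. q ^ n) summable_on UNIV"
  using assms by (intro summable_nonneg_imp_summable_on summable_geometric) auto

text \<open>The square is what the double series needs: \<open>x ^ m\<close> is accompanied by one
  \<open>r ^ m\<close> from the quotient of \<open>\<alpha>\<close> and \<open>\<gamma>\<close> and
  by another from that of \<open>\<beta>1\<close> and 1; likewise for \<open>y ^ n\<close>.\<close>

lemma ex_dilation_less_one:
  fixes \<rho> :: real
  assumes "0 \<le> \<rho>" "\<rho> < 1"
  obtains r where "r > 1" "r\<^sup>2 * \<rho> < 1"
proof (rule that[of "2 / (1 + \<rho>)"])
  have "0 < (1 - \<rho>)\<^sup>2" using assms by simp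
  then have "4 * \<rho> < (1 + \<rho>)\<^sup>2" by (simp add: power2_eq_square algebra_simps)
  then show "(2 / (1 + \<rho>))\<^sup>2 * \<rho> < 1"
    using assms by (simp add: power_divide divide_less_eq)
qed (use assms in auto)

text \<open>On a closed ball around each point the terms have a summable majorant independent of
  \<open>s\<close>. By the Weierstrass M-test the finite partial sums, which are holomorphic,
  converge uniformly there, and the limit is holomorphic inside the ball.\<close>

theorem holomorphic_appell_F1:
  assumes S: "open S"
    and hol: "\<alpha> holomorphic_on S" "\<beta>1 holomorphic_on S" "\<beta>2 holomorphic_on S" "\<gamma> holomorphic_on S"
    and \<gamma>: "\<And>s. s \<in> S \<Longrightarrow> \<gamma> s \<notin> \<int>\<^sub>\<le>\<^sub>0"
    and xy: "norm x < 1" "norm y < 1"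
  shows "(\<lambda>s. appell_F1 (\<alpha> s) (\<beta>1 s) (\<beta>2 s) (\<gamma> s) x y) holomorphic_on S"
proof -
  define F where "F s = appell_F1 (\<alpha> s) (\<beta>1 s) (\<beta>2 s) (\<gamma> s) x y" for s
  define T where "T = (\<lambda>(m, n) s. pochhammer (\<alpha> s) (m + n) * pochhammer (\<beta>1 s) m * pochhammer (\<beta>2 s) n
          / (pochhammer (\<gamma> s) (m + n) * pochhammer 1 m * pochhammer 1 n) * x ^ m * y ^ n)"
  have "pochhammer (\<gamma> s) k \<noteq> 0" if "s \<in> S" for s k
    using \<gamma>[OF that] by (metis minus_of_nat_in_nonpos_Ints pochhammer_eq_0_iff)
  then have holT: "T i holomorphic_on S" for i
    unfolding T_def case_prod_unfold
    by (intro holomorphic_intros hol) (auto simp: pochhammer_fact[symmetric])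
  have "F field_differentiable at z" if z: "z \<in> S" for z
  proof -
    obtain e where e: "e > 0" "cball z e \<subseteq> S"
      using S z open_contains_cball by blast
    have bdd: "\<exists>R. \<forall>s\<in>cball z e. norm (f s) \<le> R" if "f holomorphic_on S" for f
    proof -
      have "compact (f ` cball z e)"
        by (meson compact_cball compact_continuous_image continuous_on_subset e(2)
            holomorphic_on_imp_continuous_on that)
      then show ?thesis
        by (meson bounded_iff compact_imp_bounded image_eqI)
    qed
    obtain R1 R2 R3 R4 where R: "\<forall>s\<in>cball z e. norm (\<alpha> s) \<le> R1" "\<forall>s\<in>cball z e. norm (\<beta>1 s) \<le> R2"
      "\<forall>s\<in>cball z e. norm (\<beta>2 s) \<le> R3" "\<forall>s\<in>cball z e. norm (\<gamma> s) \<le> R4"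
      using bdd hol by metis
    \<comment> \<open>The summand 1 makes \<open>R\<close> bound the lower parameter 1 of the
      factorial quotients as well.\<close>
    define R where "R = 1 + \<bar>R1\<bar> + \<bar>R2\<bar> + \<bar>R3\<bar> + \<bar>R4\<bar>"
    have R0: "R > 0" by (simp add: R_def)
    have R_le: "norm (\<alpha> s) \<le> R" "norm (\<beta>1 s) \<le> R" "norm (\<beta>2 s) \<le> R" "norm (\<gamma> s) \<le> R"
      if "s \<in> cball z e" for s
      using R[THEN bspec, OF that] by (auto simp: R_def)
    \<comment> \<open>A compact set disjoint from the closed set of nonpositive integers has
      positive distance from it.\<close>
    have "compact (\<gamma> ` cball z e)"
      by (meson compact_cball compact_continuous_image continuous_on_subset e(2)
          holomorphic_on_imp_continuous_on hol(4))
    moreover have "\<gamma> ` cball z e \<inter> \<int>\<^sub>\<le>\<^sub>0 = {}"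
      using \<gamma> e by blast
    ultimately obtain \<delta>' where \<delta>': "\<delta>' > 0" "\<And>s t. s \<in> cball z e \<Longrightarrow> t \<in> \<int>\<^sub>\<le>\<^sub>0 \<Longrightarrow> \<delta>' \<le> dist (\<gamma> s) t"
      using separate_compact_closed[of "\<gamma> ` cball z e" "\<int>\<^sub>\<le>\<^sub>0"] by force
    \<comment> \<open>The minimum with 1 lets the same \<open>\<delta>\<close> serve the
      denominators \<open>pochhammer 1 m\<close> and \<open>pochhammer 1 n\<close>.\<close>
    define \<delta> where "\<delta> = min 1 \<delta>'"
    have \<delta>0: "\<delta> > 0" using \<delta>' by (simp add: \<delta>_def)
    have \<delta>\<gamma>: "\<delta> \<le> norm (\<gamma> s + of_nat j)" if "s \<in> cball z e" for s j
      using \<delta>'(2)[OF that, of "- of_nat j"] by (simp add: \<delta>_def dist_norm)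
    have \<delta>1: "\<delta> \<le> norm (1 + of_nat j :: complex)" for j
      by (metis \<delta>_def le_add_same_cancel1 min.coboundedI1 norm_of_nat of_nat_0_le_iff of_nat_1 of_nat_add)
    obtain r where r: "r > 1" "r\<^sup>2 * max (norm x) (norm y) < 1"
      using ex_dilation_less_one[of "max (norm x) (norm y)"] xy by (auto simp: le_max_iff_disj)
    obtain C where C: "C > 0" "\<And>(p::complex) q k. norm p \<le> R \<Longrightarrow> norm q \<le> R \<Longrightarrow>
        (\<And>j. \<delta> \<le> norm (q + of_nat j)) \<Longrightarrow> norm (pochhammer p k / pochhammer q k) \<le> C * r ^ k"
      using pochhammer_quotient_bound[of R \<delta> r, where 'a = complex] r \<delta>' R0 \<delta>0 by blast
    have rxy: "r\<^sup>2 * norm x < 1" "r\<^sup>2 * norm y < 1"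
      by (rule le_less_trans[OF mult_left_mono r(2)]; simp)+
    \<comment> \<open>Three Pochhammer quotients give \<open>C ^ 3\<close>, and
      \<open>r ^ (m + n) * r ^ m * r ^ n\<close> splits into the two factors with
      \<open>r\<^sup>2\<close>.\<close>
    define M where "M = (\<lambda>(m, n). C ^ 3 * ((r\<^sup>2 * norm x) ^ m * (r\<^sup>2 * norm y) ^ n))"
    have "Infinite_Sum.abs_summable_on (\<lambda>(m, n). (r\<^sup>2 * norm x) ^ m * (r\<^sup>2 * norm y) ^ n) (UNIV \<times> UNIV)"
      using rxy by (intro abs_summable_on_mult_Times) (auto intro!: summable_on_geometric simp: norm_mult norm_power)
    then have M: "M summable_on UNIV"
      using summable_on_cmult_right[OF abs_summable_summable]
      unfolding M_def case_prod_unfold by fastforce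
    have le: "norm (T i s) \<le> M i" if s: "s \<in> cball z e" for i s
    proof -
      obtain m n where i: "i = (m, n)" by force
      have R1: "norm (1::complex) \<le> R" by (simp add: R_def)
      have "T i s = (pochhammer (\<alpha> s) (m + n) / pochhammer (\<gamma> s) (m + n)) * (pochhammer (\<beta>1 s) m / pochhammer 1 m)
          * (pochhammer (\<beta>2 s) n / pochhammer 1 n) * x ^ m * y ^ n"
        by (simp add: T_def i)
      also have "norm \<dots> \<le> (C * r ^ (m + n)) * (C * r ^ m) * (C * r ^ n) * norm x ^ m * norm y ^ n"
        unfolding norm_mult norm_power
        using C(1) r by (intro mult_mono C(2) R_le \<delta>\<gamma> \<delta>1 R1 s mult_nonneg_nonneg norm_ge_zero order.refl zero_le_power) auto
      also have "\<dots> = M i"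
        by (simp add: M_def i power_add power_mult_distrib power2_eq_square power3_eq_cube mult_ac)
      finally show ?thesis .
    qed
    have F_eq: "F s = (\<Sum>\<^sub>\<infinity>i\<in>UNIV. T i s)" for s
      by (simp add: F_def appell_F1_def T_def case_prod_unfold)
    have "uniform_limit (cball z e) (\<lambda>X s. \<Sum>i\<in>X. T i s) F (finite_subsets_at_top UNIV)"
      unfolding F_eq[abs_def] by (rule Weierstrass_m_test_general[OF le M])
    moreover have "(\<lambda>s. \<Sum>i\<in>X. T i s) holomorphic_on S" for X
      by (intro holomorphic_intros holT)
    then have "continuous_on (cball z e) (\<lambda>s. \<Sum>i\<in>X. T i s) \<and> (\<lambda>s. \<Sum>i\<in>X. T i s) holomorphic_on ball z e" for X
      by (meson ball_subset_cball continuous_on_subset e(2) holomorphic_on_imp_continuous_on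
          holomorphic_on_subset order_trans)
    ultimately have "F holomorphic_on ball z e"
      by (elim holomorphic_uniform_limit[rotated]) (auto intro!: always_eventually)
    then show ?thesis
      using e by (auto intro: holomorphic_on_imp_differentiable_at)
  qed
  then show ?thesis
    unfolding F_def[symmetric, abs_def]
    by (auto simp: holomorphic_on_def intro: field_differentiable_at_within)
qed

section \<open>Euler's integral\<close>

lemma abs_summable_pochhammer_powser:
  fixes \<beta> z :: real
  assumes "\<bar>z\<bar> < 1"
  shows "Infinite_Sum.abs_summable_on (\<lambda>n. pochhammer \<beta> n / pochhammer 1 n * z ^ n) UNIV"
proof -
  obtain r where r: "r > 1" "r\<^sup>2 * \<bar>z\<bar> < 1"
    using ex_dilation_less_one[of "\<bar>z\<bar>"] assms by auto
  obtain C where C: "C > 0" "\<And>(p::real) q k. norm p \<le> 1 + \<bar>\<beta>\<bar> \<Longrightarrow> norm q \<le> 1 + \<bar>\<beta>\<bar> \<Longrightarrow>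
      (\<And>j. 1 \<le> norm (q + of_nat j)) \<Longrightarrow> norm (pochhammer p k / pochhammer q k) \<le> C * r ^ k"
    using pochhammer_quotient_bound[of "1 + \<bar>\<beta>\<bar>" 1 r, where 'a = real] r by fastforce
  have "r * \<bar>z\<bar> \<le> r\<^sup>2 * \<bar>z\<bar>"
    using r by (intro mult_right_mono) (auto simp: power2_eq_square)
  then have "(\<lambda>n. C * (r * \<bar>z\<bar>) ^ n) summable_on UNIV"
    using r by (intro summable_on_cmult_right summable_on_geometric) auto
  then show ?thesis
  proof (rule Infinite_Sum.summable_on_comparison_test)
    fix n
    have "norm (pochhammer \<beta> n / pochhammer 1 n * z ^ n) = norm (pochhammer \<beta> n / pochhammer 1 n) * \<bar>z\<bar> ^ n"
      by (simp add: abs_mult power_abs)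
    also have "\<dots> \<le> (C * r ^ n) * \<bar>z\<bar> ^ n"
      by (intro mult_right_mono C) auto
    finally show "norm (pochhammer \<beta> n / pochhammer 1 n * z ^ n) \<le> C * (r * \<bar>z\<bar>) ^ n"
      by (simp add: power_mult_distrib)
  qed auto
qed

text \<open>This is the binomial series with exponent \<open>- \<beta>\<close> at
  \<open>- z\<close>, the two signs cancelling termwise; absolute summability turns the ordered sum
  into an unordered one.\<close>

lemma infsum_pochhammer_powser:
  fixes \<beta> z :: real
  assumes "\<bar>z\<bar> < 1"
  shows "(\<Sum>\<^sub>\<infinity>n. pochhammer \<beta> n / pochhammer 1 n * z ^ n) = (1 - z) powr (- \<beta>)"
proof -
  have "(\<lambda>n. ((- \<beta>) gchoose n) * (- z) ^ n) sums (1 + - z) powr (- \<beta>)"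
    using assms by (intro gen_binomial_real) auto
  moreover have "((- \<beta>) gchoose n) * (- z) ^ n = pochhammer \<beta> n / pochhammer 1 n * z ^ n" for n
    by (simp add: gbinomial_pochhammer power_minus[of z] pochhammer_fact[symmetric])
  ultimately have "(\<lambda>n. pochhammer \<beta> n / pochhammer 1 n * z ^ n) sums (1 - z) powr (- \<beta>)"
    by simp
  moreover have "summable (\<lambda>n. norm (pochhammer \<beta> n / pochhammer 1 n * z ^ n))"
    using abs_summable_pochhammer_powser[OF assms] by (rule summable_on_imp_summable)
  ultimately show ?thesis
    by (metis infsumI norm_summable_imp_has_sum)
qed

text \<open>In Euler's integral the extra power \<open>t ^ k\<close> of a series term shifts the
  first Beta parameter, and this ratio is the source of the quotient of \<open>\<alpha>\<close> and
  \<open>\<gamma>\<close> in the Appell series.\<close>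

lemma Beta_add_nat:
  fixes a b :: real
  assumes "a > 0" "b > 0"
  shows "Beta (a + real k) b = pochhammer a k / pochhammer (a + b) k * Beta a b"
proof -
  have "a \<notin> \<int>\<^sub>\<le>\<^sub>0" "a + b \<notin> \<int>\<^sub>\<le>\<^sub>0" "Gamma a \<noteq> 0" "Gamma (a + b) \<noteq> 0" "Gamma (a + b + real k) \<noteq> 0"
    using assms by (auto elim!: nonpos_Ints_cases simp: Gamma_eq_zero_iff)
  then show ?thesis
    by (simp add: pochhammer_Gamma Beta_def add_ac)
qed

text \<open>Expand the last two factors of the integrand in binomial series and integrate term by
  term; each term is a Beta integral. The lower bounds on \<open>\<alpha>\<close> and
  \<open>\<gamma>\<close> make both exponents of the weight positive, so it is continuous and at
  most 1 on the closed interval and the M-test applies.\<close>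

theorem appell_F1_Euler_integral:
  fixes \<alpha> \<beta>1 \<beta>2 \<gamma> x y J :: real
  assumes \<alpha>: "\<alpha> > 1" and \<gamma>: "\<gamma> > \<alpha> + 1" and xy: "\<bar>x\<bar> < 1" "\<bar>y\<bar> < 1"
    and J: "((\<lambda>t. t powr (\<alpha> - 1) * (1 - t) powr (\<gamma> - \<alpha> - 1) * (1 - x * t) powr (- \<beta>1) * (1 - y * t) powr (- \<beta>2))
              has_integral J) {0..1}"
  shows "appell_F1 \<alpha> \<beta>1 \<beta>2 \<gamma> x y = of_real (J / Beta \<alpha> (\<gamma> - \<alpha>))"
proof -
  define A where "A = (\<lambda>m. pochhammer \<beta>1 m / pochhammer 1 m)"
  define B where "B = (\<lambda>n. pochhammer \<beta>2 n / pochhammer 1 n)"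
  define w where "w t = t powr (\<alpha> - 1) * (1 - t) powr (\<gamma> - \<alpha> - 1)" for t
  define f where "f = (\<lambda>(m, n) t. w t * (A m * (x * t) ^ m * (B n * (y * t) ^ n)))"
  define M where "M = (\<lambda>(m, n). (A m * x ^ m) * (B n * y ^ n))"
  have abs_w: "\<bar>w t\<bar> \<le> 1" if "t \<in> {0..1}" for t
  proof -
    have "t powr (\<alpha> - 1) \<le> 1" "(1 - t) powr (\<gamma> - \<alpha> - 1) \<le> 1"
      using that \<alpha> \<gamma> by (auto intro!: powr_le1)
    then show ?thesis
      by (auto simp: w_def intro!: mult_le_one)
  qed
  have M: "Infinite_Sum.abs_summable_on M UNIV"
    using abs_summable_on_mult_Times[OF abs_summable_pochhammer_powser[OF xy(1), of \<beta>1]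
        abs_summable_pochhammer_powser[OF xy(2), of \<beta>2]]
    by (simp add: M_def A_def B_def)
  have le: "norm (f i t) \<le> norm (M i)" if t: "t \<in> {0..1}" for i t
  proof -
    obtain m n where i: "i = (m, n)" by force
    have "f i t = M i * (w t * (t ^ m * t ^ n))"
      by (simp add: f_def M_def i power_mult_distrib)
    also have "norm \<dots> \<le> norm (M i) * (1 * (1 * 1))"
      unfolding norm_mult using t abs_w[OF t]
      by (intro mult_mono) (auto simp: power_le_one)
    finally show ?thesis by simp
  qed
  have val: "(\<Sum>\<^sub>\<infinity>i. f i t) = w t * (1 - x * t) powr (- \<beta>1) * (1 - y * t) powr (- \<beta>2)" if t: "t \<in> {0..1}" for t
  proof -
    have "\<bar>x\<bar> * t \<le> \<bar>x\<bar> * 1" "\<bar>y\<bar> * t \<le> \<bar>y\<bar> * 1"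
      using t by (intro mult_left_mono; simp)+
    then have xyt: "\<bar>x * t\<bar> < 1" "\<bar>y * t\<bar> < 1"
      using xy t by (auto simp: abs_mult)
    have "(\<Sum>\<^sub>\<infinity>i. f i t) = w t * (\<Sum>\<^sub>\<infinity>(m, n)\<in>UNIV \<times> UNIV. A m * (x * t) ^ m * (B n * (y * t) ^ n))"
      by (simp add: f_def case_prod_unfold infsum_cmult_right')
    also have "\<dots> = w t * ((1 - x * t) powr (- \<beta>1) * (1 - y * t) powr (- \<beta>2))"
      unfolding A_def B_def
      by (subst infsum_mult_Times) (simp_all only: abs_summable_pochhammer_powser infsum_pochhammer_powser xyt)
    finally show ?thesis by simp
  qed
  have unif: "uniform_limit {0..1} (\<lambda>X t. \<Sum>i\<in>X. f i t) (\<lambda>t. \<Sum>\<^sub>\<infinity>i. f i t) (finite_subsets_at_top UNIV)"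
    by (rule Weierstrass_m_test_general[OF le M])
  have w: "continuous_on {0..1} w"
    unfolding w_def [abs_def] using \<alpha> \<gamma> by (intro continuous_on_mult continuous_on_powr') (auto intro!: continuous_intros)
  have cont: "continuous_on {0..1} (\<lambda>t. \<Sum>i\<in>X. f i t)" for X
    unfolding f_def case_prod_unfold by (intro continuous_intros w)
  \<comment> \<open>Uniform convergence along the finite index sets lets the integral pass through
    the unordered sum.\<close>
  obtain I J' where IJ: "\<And>X. ((\<lambda>t. \<Sum>i\<in>X. f i t) has_integral I X) {0..1}"
    "((\<lambda>t. \<Sum>\<^sub>\<infinity>i. f i t) has_integral J') {0..1}" "(I \<longlongrightarrow> J') (finite_subsets_at_top UNIV)"
    using uniform_limit_integral[OF unif cont] by auto
  define c where "c = (\<lambda>(m, n). A m * x ^ m * (B n * y ^ n) * Beta (\<alpha> + real (m + n)) (\<gamma> - \<alpha>))"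
  have "(f i has_integral c i) {0..1}" for i
  proof -
    obtain m n where i: "i = (m, n)" by force
    have "((\<lambda>t. M i * (t powr (\<alpha> + real (m + n) - 1) * (1 - t) powr (\<gamma> - \<alpha> - 1))) has_integral c i) {0..1}"
      unfolding c_def M_def i prod.case using \<alpha> \<gamma>
      by (intro has_integral_mult_right has_integral_Beta_real) auto
    then show ?thesis
    proof (rule has_integral_eq[rotated])
      fix t :: real assume "t \<in> {0..1}"
      \<comment> \<open>At \<open>t = 0\<close> both sides are 0, since \<open>0 powr\<close> any
        exponent is 0.\<close>
      then have "t powr (\<alpha> + real (m + n) - 1) = t powr (\<alpha> - 1) * (t ^ m * t ^ n)"
        by (cases "t = 0") (auto simp: powr_add powr_diff powr_realpow power_add)
      then show "M i * (t powr (\<alpha> + real (m + n) - 1) * (1 - t) powr (\<gamma> - \<alpha> - 1)) = f i t"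
        by (simp add: M_def f_def i w_def power_mult_distrib)
    qed
  qed
  then have "((\<lambda>t. \<Sum>i\<in>X. f i t) has_integral (\<Sum>i\<in>X. c i)) {0..1}" if "finite X" for X
    using that by (intro has_integral_sum)
  then have I: "I X = (\<Sum>i\<in>X. c i)" if "finite X" for X
    using that IJ(1) has_integral_unique by blast
  have "J' = J"
  proof -
    have "((\<lambda>t. \<Sum>\<^sub>\<infinity>i. f i t) has_integral J) {0..1}"
      by (rule has_integral_eq[OF _ J]) (simp add: val w_def)
    then show ?thesis
      using IJ(2) has_integral_unique by blast
  qed
  have "(c has_sum J) UNIV"
    unfolding has_sum_def
    using IJ(3) \<open>J' = J\<close>
    by (auto elim!: Lim_transform_eventually intro!: eventually_finite_subsets_at_top_weakI simp: I)
  moreover have Beta0: "Beta \<alpha> (\<gamma> - \<alpha>) \<noteq> 0"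
    using \<alpha> \<gamma> by (simp add: Beta_def Gamma_eq_zero_iff) (auto elim!: nonpos_Ints_cases)
  ultimately have "((\<lambda>i. complex_of_real (c i / Beta \<alpha> (\<gamma> - \<alpha>))) has_sum of_real (J / Beta \<alpha> (\<gamma> - \<alpha>))) UNIV"
    by (intro has_sum_of_real has_sum_divide_const)
  moreover have "complex_of_real (c i / Beta \<alpha> (\<gamma> - \<alpha>)) = (case i of (m, n) \<Rightarrow>
      pochhammer (of_real \<alpha>) (m + n) * pochhammer (of_real \<beta>1) m * pochhammer (of_real \<beta>2) n
          / (pochhammer (of_real \<gamma>) (m + n) * pochhammer 1 m * pochhammer 1 n) * of_real x ^ m * of_real y ^ n)" for i
  proof -
    obtain m n where i: "i = (m, n)" by force
    have "c i / Beta \<alpha> (\<gamma> - \<alpha>) = pochhammer \<alpha> (m + n) * pochhammer \<beta>1 m * pochhammer \<beta>2 n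
          / (pochhammer \<gamma> (m + n) * pochhammer 1 m * pochhammer 1 n) * x ^ m * y ^ n"
      using Beta0 Beta_add_nat[of \<alpha> "\<gamma> - \<alpha>" "m + n"] \<alpha> \<gamma> by (simp add: c_def i A_def B_def mult_ac)
    moreover have "pochhammer (1 :: complex) k = of_real (pochhammer 1 k)" for k
      using pochhammer_of_real[of 1 k] by simp
    ultimately show ?thesis
      by (simp add: i pochhammer_of_real)
  qed
  ultimately show ?thesis
    unfolding appell_F1_def by (simp add: infsumI)
qed

section \<open>Evaluation of the integral\<close>

text \<open>With phi and C as in the overview, \<open>262144/84375\<close> is 4C and s(1 - s) =
  phi/(4C). The integrand is (4C)^a / 2 times s' (s(1 - s))^(a - 1): the powers -3/2 and -7/2 in s'
  account for the exponents \<open>a + 1/2\<close> and \<open>5 * a - 3/2\<close>.\<close>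

lemma has_integral_Euler_integrand:
  fixes a :: real
  assumes a: "a > 1"
  shows "((\<lambda>t. t powr (2 * a - 1) * (1 - t) powr (a - 1) * (1 - 3/128 * t) powr (- (a + 1/2))
            * (1 - 3/8 * t) powr (- (5 * a - 3/2))) has_integral
          (262144/84375) powr a / 2 * Beta a a) {0..1}"
proof -
  \<comment> \<open>\<open>P\<close> is the numerator of the logarithmic derivative of \<open>t\<^sup>2 (1 - t) / (X t * Y t ^ 5)\<close>
    over the denominator \<open>t (1 - t) (X t) (Y t)\<close>; it changes sign in \<open>(0, 1)\<close>, and so does \<open>v\<close>.\<close>
  define P where "P t = 2 - 243/128 * t - 189/256 * t^2 + 27/1024 * t^3" for t :: real
  define X where "X t = 1 - 3/128 * t" for t :: real
  define Y where "Y t = 1 - 3/8 * t" for t :: real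
  define v where "v t = P t / 2 * X t powr (-1/2) * Y t powr (-5/2)" for t
  define s where "s t = (1 - v t) / 2" for t
  \<comment> \<open>Differentiating v^2 = 1 - phi/C gives 2 v v' = - phi'/C, and the factor
    \<open>P\<close> of phi' cancels against that of v. So s' = - v'/2 has no zero in (0,1]; its
    constant is 1/(2C).\<close>
  define s' where "s' t = 84375/131072 * t * X t powr (-3/2) * Y t powr (-7/2)" for t
  have pos: "X t > 0" "Y t > 0" if "t \<in> {0..1}" for t
    using that by (auto simp: X_def Y_def)
  \<comment> \<open>The identity 1 - phi/C = P^2 / (4 X Y^5) with denominators cleared;
    \<open>84375/65536\<close> is 1/C.\<close>
  have ident: "X t * Y t ^ 5 - P t ^ 2 / 4 = 84375/65536 * (t^2 * (1 - t))" for t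
    unfolding P_def X_def Y_def by algebra
  have v2: "v t ^ 2 = P t ^ 2 / 4 / (X t * Y t ^ 5)" if t: "t \<in> {0..1}" for t
  proof -
    have "(X t powr (-1/2)) ^ 2 = inverse (X t)" "(Y t powr (-5/2)) ^ 2 = inverse (Y t ^ 5)"
      unfolding power2_eq_square powr_add[symmetric]
      using pos[OF t] by (simp_all add: powr_minus powr_numeral)
    then show ?thesis
      by (simp add: v_def power_mult_distrib power_divide field_simps)
  qed
  have ss: "s t * (1 - s t) = 84375/262144 * (t^2 * (1 - t)) / (X t * Y t ^ 5)" if t: "t \<in> {0..1}" for t
  proof -
    have "s t * (1 - s t) = (1 - v t ^ 2) / 4"
      by (simp add: s_def power2_eq_square field_simps)
    also have "1 - v t ^ 2 = (X t * Y t ^ 5 - P t ^ 2 / 4) / (X t * Y t ^ 5)"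
      using pos[OF t] by (simp add: v2[OF t] diff_divide_distrib)
    finally show ?thesis
      by (simp add: ident)
  qed
  \<comment> \<open>Nonnegativity of \<open>s t * (1 - s t)\<close> confines \<open>s t\<close> to
    the unit interval.\<close>
  have s01: "s t \<in> {0..1}" if t: "t \<in> {0..1}" for t
  proof -
    have "s t * (1 - s t) \<ge> 0"
      using pos[OF t] t by (simp add: ss[OF t])
    then show ?thesis
      by (auto simp: zero_le_mult_iff)
  qed
  have s0: "s 0 = 0"
    by (simp add: s_def v_def P_def X_def Y_def)
  \<comment> \<open>Since phi(1) = 0, \<open>s 1\<close> is 0 or 1; the negative sign of
    \<open>P 1\<close> selects 1. This is where giving v the sign of \<open>P\<close>
    matters.\<close>
  have s1: "s 1 = 1"
  proof -
    have "s 1 * (1 - s 1) = 0"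
      by (simp add: ss)
    moreover have "v 1 < 0"
      by (simp add: v_def P_def X_def Y_def)
    ultimately show ?thesis
      by (auto simp: s_def)
  qed
  have deriv: "(s has_field_derivative s' t) (at t within {0..1})" if t: "t \<in> {0..1}" for t
  proof -
    define U where "U = X t powr (-3/2)"
    define V where "V = Y t powr (-7/2)"
    \<comment> \<open>Expressing all powers through \<open>U\<close> and \<open>V\<close> turns the
      formula for the derivative into a polynomial identity times \<open>U * V\<close>.\<close>
    have pw: "X t powr (-1/2) = X t * U" "Y t powr (-5/2) = Y t * V"
      using pos[OF t] powr_mult_base[of "X t" "-3/2"] powr_mult_base[of "Y t" "-7/2"]
      by (simp_all add: U_def V_def)
    define dP where "dP = - 243/128 - 189/128 * t + 81/1024 * t^2"
    have "(P has_field_derivative dP) (at t)"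
      unfolding P_def [abs_def] dP_def by (auto intro!: derivative_eq_intros)
    moreover have "((\<lambda>t. X t powr (-1/2)) has_field_derivative 3/256 * U) (at t)"
      unfolding X_def U_def using pos(1)[OF t, unfolded X_def]
      by (auto intro!: derivative_eq_intros DERIV_fun_powr)
    moreover have "((\<lambda>t. Y t powr (-5/2)) has_field_derivative 15/16 * V) (at t)"
      unfolding Y_def V_def using pos(2)[OF t, unfolded Y_def]
      by (auto intro!: derivative_eq_intros DERIV_fun_powr)
    ultimately have "(s has_field_derivative
        (0 - ((dP / 2 * X t powr (-1/2) + 3/256 * U * (P t / 2)) * Y t powr (-5/2)
          + 15/16 * V * (P t / 2 * X t powr (-1/2)))) / 2) (at t)"
      unfolding s_def [abs_def] v_def
      by (intro DERIV_cdivide DERIV_diff DERIV_const DERIV_mult)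
    also have "(0 - ((dP / 2 * X t powr (-1/2) + 3/256 * U * (P t / 2)) * Y t powr (-5/2)
          + 15/16 * V * (P t / 2 * X t powr (-1/2)))) / 2 = s' t"
      unfolding pw s'_def U_def[symmetric] V_def[symmetric] unfolding P_def X_def Y_def dP_def
      by (simp add: field_simps power2_eq_square power3_eq_cube)
    finally show ?thesis
      by (rule has_field_derivative_at_within)
  qed
  define g where "g u = u powr (a - 1) * (1 - u) powr (a - 1)" for u :: real
  have "((\<lambda>t. s' t *\<^sub>R g (s t)) has_integral (integral {s 0..s 1} g)) {0..1}"
  proof (rule has_integral_substitution[where c = 0 and d = 1])
    show "continuous_on {0..1} g"
      unfolding g_def [abs_def] using a
      by (intro continuous_on_mult continuous_on_powr') (auto intro!: continuous_intros)
  qed (use s01 s0 s1 deriv in auto)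
  moreover have "integral {0..1} g = Beta a a"
    unfolding g_def [abs_def] using a by (intro integral_unique has_integral_Beta_real) auto
  ultimately have "((\<lambda>t. s' t * g (s t)) has_integral Beta a a) {0..1}"
    by (simp add: s0 s1)
  \<comment> \<open>The factor cancels all constants: s' contributes 2/(4C) and
    \<open>g (s t)\<close> contributes (4C)^(1 - a).\<close>
  then have "((\<lambda>t. (262144/84375) powr a / 2 * (s' t * g (s t))) has_integral
      (262144/84375) powr a / 2 * Beta a a) {0..1}"
    by (rule has_integral_mult_right)
  then show ?thesis
  proof (rule has_integral_eq[rotated])
    fix t :: real assume t: "t \<in> {0..1}"
    note p = pos[OF t]
    have "g (s t) = (s t * (1 - s t)) powr (a - 1)"
      using s01[OF t] by (simp add: g_def powr_mult)
    also have "\<dots> = (84375/262144) powr (a - 1) * (t powr (a - 1) * t powr (a - 1) * (1 - t) powr (a - 1))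
        / (X t powr (a - 1) * (Y t ^ 5) powr (a - 1))"
      using p t by (simp add: ss powr_mult powr_divide power2_eq_square)
    also have "(Y t ^ 5) powr (a - 1) = Y t powr (5 * (a - 1))"
      using p by (simp add: powr_powr flip: powr_numeral)
    also have "(84375/262144::real) powr (a - 1) = (262144/84375) * inverse ((262144/84375) powr a)"
      by (simp add: powr_diff powr_divide)
    finally have g: "g (s t) = (262144/84375) * inverse ((262144/84375) powr a)
        * (t powr (a - 1) * t powr (a - 1) * (1 - t) powr (a - 1)) / (X t powr (a - 1) * Y t powr (5 * (a - 1)))" .
    have T: "t * (t powr (a - 1) * t powr (a - 1)) = t powr (2 * a - 1)"
      using t powr_mult_base[of t "2 * a - 2"] by (simp flip: powr_add)
    have XX: "X t powr (-3/2) / X t powr (a - 1) = X t powr (- (a + 1/2))"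
      unfolding powr_diff[symmetric] by (rule arg_cong[where f = "(powr) _"]) simp
    have YY: "Y t powr (-7/2) / Y t powr (5 * (a - 1)) = Y t powr (- (5 * a - 3/2))"
      unfolding powr_diff[symmetric] by (rule arg_cong[where f = "(powr) _"]) simp
    have "(262144/84375) powr a / 2 * (s' t * g (s t))
        = (t * (t powr (a - 1) * t powr (a - 1))) * (1 - t) powr (a - 1)
          * (X t powr (-3/2) / X t powr (a - 1)) * (Y t powr (-7/2) / Y t powr (5 * (a - 1)))"
      by (simp add: s'_def g)
    also have "\<dots> = t powr (2 * a - 1) * (1 - t) powr (a - 1) * X t powr (- (a + 1/2)) * Y t powr (- (5 * a - 3/2))"
      unfolding T XX YY ..
    finally show "(262144/84375) powr a / 2 * (s' t * g (s t)) =
        t powr (2 * a - 1) * (1 - t) powr (a - 1) * (1 - 3/128 * t) powr (- (a + 1/2))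
            * (1 - 3/8 * t) powr (- (5 * a - 3/2))"
      by (simp add: X_def Y_def)
  qed
qed

text \<open>The two Beta values leave Gamma(a) Gamma(3a) / Gamma(2a)^2. Legendre duplication
  replaces Gamma(a); its factor 2^(1 - 2a) lowers 2^(18a) to 2^(16a) and cancels the 1/2 of the
  integral.\<close>

lemma appell_F1_special_value_real:
  fixes a :: real
  assumes a: "a > 1"
  defines "z \<equiv> complex_of_real a"
  shows "appell_F1 (2 * z) (z + 1/2) (5 * z - 3/2) (3 * z) (3/128) (3/8)
    = 2 powr (16 * z) / (3 powr (3 * z) * 5 powr (5 * z))
      * (of_real (sqrt pi) * Gamma (3 * z) * rGamma (z + 1/2) * rGamma (2 * z))"
proof -
  have "appell_F1 (of_real (2 * a)) (of_real (a + 1/2)) (of_real (5 * a - 3/2)) (of_real (3 * a)) (of_real (3/128)) (of_real (3/8))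
      = of_real ((262144/84375) powr a / 2 * Beta a a / Beta (2 * a) (3 * a - 2 * a))"
    by (rule appell_F1_Euler_integral) (use has_integral_Euler_integrand[OF a] a in auto)
  also have "(262144/84375) powr a / 2 * Beta a a / Beta (2 * a) (3 * a - 2 * a)
      = 2 powr (16 * a) / (3 powr (3 * a) * 5 powr (5 * a))
        * (sqrt pi * Gamma (3 * a) * rGamma (a + 1/2) * rGamma (2 * a))"
  proof -
    have nz: "Gamma a > 0" "Gamma (a + 1/2) > 0" "Gamma (2 * a) > 0" "Gamma (3 * a) > 0"
      using a by auto
    have nI: "z \<notin> \<int>\<^sub>\<le>\<^sub>0" "z + 1/2 \<notin> \<int>\<^sub>\<le>\<^sub>0"
      using a by (auto elim!: nonpos_Ints_cases simp: z_def complex_eq_iff)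
    \<comment> \<open>Duplication is applied at the complex point \<open>z\<close> and read back
      over the reals by injectivity of \<open>of_real\<close>.\<close>
    have "Gamma z * Gamma (z + 1/2) = exp ((1 - 2*z) * of_real (ln 2)) * of_real (sqrt pi) * Gamma (2*z)"
      by (rule Gamma_legendre_duplication[OF nI])
    also have "z + 1/2 = of_real (a + 1/2)" by (simp add: z_def)
    also have "2 * z = of_real (2 * a)" by (simp add: z_def)
    also have "(1 - of_real (2 * a)) * of_real (ln 2) = complex_of_real ((1 - 2 * a) * ln 2)" by simp
    finally have "complex_of_real (Gamma a * Gamma (a + 1/2)) = of_real (exp ((1 - 2 * a) * ln 2) * sqrt pi * Gamma (2 * a))"
      by (simp only: z_def Gamma_complex_of_real exp_of_real flip: of_real_mult)
    then have dup: "Gamma a * Gamma (a + 1/2) = 2 powr (1 - 2 * a) * sqrt pi * Gamma (2 * a)"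
      unfolding of_real_eq_iff by (simp add: powr_def)
    have "(262144/84375::real) powr a = 2 powr (18 * a) / (3 powr (3 * a) * 5 powr (5 * a))"
    proof -
      have "(262144/84375::real) = 2 powr 18 / (3 powr 3 * 5 powr 5)" by simp
      then show ?thesis
        by (simp only: powr_divide powr_mult powr_powr powr_ge_zero mult_nonneg_nonneg)
    qed
    moreover have "(2::real) powr (18 * a) = 2 powr (16 * a) * 2 powr (2 * a)"
      by (simp flip: powr_add)
    ultimately have C: "(262144/84375::real) powr a = 2 powr (16 * a) * 2 powr (2 * a) / (3 powr (3 * a) * 5 powr (5 * a))"
      by simp
    have "Beta a a / Beta (2 * a) (3 * a - 2 * a) = Gamma a * Gamma (3 * a) / (Gamma (2 * a) * Gamma (2 * a))"
      using nz by (simp add: Beta_def field_simps)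
    also have "\<dots> = 2 / 2 powr (2 * a) * (sqrt pi * Gamma (3 * a) * rGamma (a + 1/2) * rGamma (2 * a))"
    proof -
      have "Gamma a = 2 / 2 powr (2 * a) * sqrt pi * Gamma (2 * a) / Gamma (a + 1/2)"
        using dup nz by (simp add: powr_diff field_simps)
      then show ?thesis
        using nz by (simp add: rGamma_inverse_Gamma field_simps)
    qed
    finally have B: "Beta a a / Beta (2 * a) (3 * a - 2 * a)
        = 2 / 2 powr (2 * a) * (sqrt pi * Gamma (3 * a) * rGamma (a + 1/2) * rGamma (2 * a))" .
    have "(262144/84375) powr a / 2 * Beta a a / Beta (2 * a) (3 * a - 2 * a)
        = (262144/84375) powr a / 2 * (Beta a a / Beta (2 * a) (3 * a - 2 * a))"
      by simp
    also have "\<dots> = 2 powr (16 * a) / (3 powr (3 * a) * 5 powr (5 * a))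
        * (sqrt pi * Gamma (3 * a) * rGamma (a + 1/2) * rGamma (2 * a))"
      unfolding B C by simp
    finally show ?thesis .
  qed
  finally show ?thesis
    using Gamma_complex_of_real[of "3 * a"] rGamma_complex_of_real[of "a + 1/2"] rGamma_complex_of_real[of "2 * a"]
    by (simp add: z_def flip: powr_of_real)
qed

section \<open>Analytic continuation to complex parameters\<close>

theorem mainTheorem9:
  fixes a :: complex
  assumes "3 * a \<notin> \<int>\<^sub>\<le>\<^sub>0"
  shows "appell_F1 (2 * a) (a + 1/2) (5 * a - 3/2) (3 * a) (3/128) (3/8)
    = 2 powr (16 * a) / (3 powr (3 * a) * 5 powr (5 * a))
      * (of_real (sqrt pi) * Gamma (3 * a) * rGamma (a + 1/2) * rGamma (2 * a))"
proof -
  define S where "S = {s::complex. 3 * s \<notin> \<int>\<^sub>\<le>\<^sub>0}"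
  define D where "D s = appell_F1 (2 * s) (s + 1/2) (5 * s - 3/2) (3 * s) (3/128) (3/8)
    - 2 powr (16 * s) / (3 powr (3 * s) * 5 powr (5 * s))
      * (of_real (sqrt pi) * Gamma (3 * s) * rGamma (s + 1/2) * rGamma (2 * s))" for s
  have "open ((*) 3 -` (- \<int>\<^sub>\<le>\<^sub>0 :: complex set))"
    by (intro open_vimage continuous_intros) (auto simp: open_closed)
  then have S: "open S"
    by (simp add: S_def vimage_def)
  \<comment> \<open>The plane minus a countable set is connected, provided the remainder is
    open.\<close>
  have "S = UNIV - (\<lambda>z. z / 3) ` \<int>\<^sub>\<le>\<^sub>0"
    by (auto simp: S_def image_iff mult.commute)
  moreover have "countable (\<int>\<^sub>\<le>\<^sub>0 :: complex set)"
    by (rule countable_subset[OF _ countable_int]) (auto elim!: nonpos_Ints_cases)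
  ultimately have "connected S"
    using connected_open_diff_countable[of "UNIV :: complex set" "(\<lambda>z. z / 3) ` \<int>\<^sub>\<le>\<^sub>0"] connected_UNIV by simp
  \<comment> \<open>\<open>rGamma\<close> is entire and the powers of 3 and 5 never vanish, so on
    \<open>S\<close> only \<open>Gamma (3 * s)\<close> and the lower parameter \<open>3 * s\<close>
    could cause singularities, and \<open>S\<close> excludes these.\<close>
  have hol: "D holomorphic_on S"
    unfolding D_def by (intro holomorphic_intros holomorphic_appell_F1 S) (auto simp: S_def)
  have sub: "complex_of_real ` {1<..<2} \<subseteq> S" and two: "2 \<in> S"
    by (auto simp: S_def complex_eq_iff elim!: nonpos_Ints_cases)
  \<comment> \<open>The known zeros of \<open>D\<close> fill the real interval (1,2), and its
    endpoint 2 is an accumulation point lying in \<open>S\<close>.\<close>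
  have lim: "2 islimpt complex_of_real ` {1<..<2}"
  proof -
    have "(2::real) islimpt {1<..<2}"
      by (rule islimpt_greaterThanLessThan2) simp
    moreover have "dist (complex_of_real t) 2 = dist t 2" for t
      using dist_of_real[of t 2, where 'a = complex] by simp
    moreover have "complex_of_real t \<noteq> 2" if "t < 2" for t
      using that of_real_eq_iff[of t 2, where 'a = complex] by simp
    ultimately show ?thesis
      unfolding islimpt_approachable by (metis greaterThanLessThan_iff imageI)
  qed
  have zero: "D z = 0" if "z \<in> complex_of_real ` {1<..<2}" for z
    using that appell_F1_special_value_real unfolding D_def by auto
  have "a \<in> S"
    using assms by (simp add: S_def)
  then have "D a = 0"
    using zero by (rule analytic_continuation[OF hol S \<open>connected S\<close> sub two lim, rotated])
  then show ?thesis
    by (simp add: D_def)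
qed

end
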